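(* Let $D(n)=\max_{1\le i\le n} d(i)$, where $d(i)$ is the number of positive divisors of $i$, and let $\omega(n)=D(n)^{100}$. If $p=p(n)\le n^{-1/9}\omega(n)^{-1}$, then asymptotically almost surely (i.e. with probability tending to $1$ as $n\to\infty$) the random set $[n]_p$ is not product-Schur.
   Context: $[n]_p$ is the random subset of $[n]=\{1,\dots,n\}$ containing each integer independently with probability $p$. A set $A\subseteq\mathbb{N}$ is product-Schur if every 2-colouring of $A$ yields $a,b,c\in A$ of the same colour with $ab=c$ ($a=b$ allowed). *)

theory Defs
  imports "HOL-Probability.Probability"
begin

definition num_divisors :: "nat \<Rightarrow> nat" where
  "num_divisors i = card {k. k dvd i}"

(* Only meaningful for n \<ge> 1; for n = 0 it is the maximum of the empty set. *)
definition max_divisors :: "nat \<Rightarrow> nat" where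
  "max_divisors n = Max (num_divisors ` {1..n})"

definition omega :: "nat \<Rightarrow> real" where
  "omega n = real (max_divisors n) ^ 100"

(* A 2-colouring of A is given by a map on all of nat; its values outside A are irrelevant.
   The elements a, b, c need not be distinct, so any set containing 1 is product-Schur. *)
definition product_Schur :: "nat set \<Rightarrow> bool" where
  "product_Schur A \<longleftrightarrow>
     (\<forall>col :: nat \<Rightarrow> bool. \<exists>a\<in>A. \<exists>b\<in>A. \<exists>c\<in>A.
        col a = col b \<and> col b = col c \<and> a * b = c)"

(* The distribution of [n]_q, as the image of n independent Bernoulli(q) indicators.
   bernoulli_pmf clips its parameter, so q is meant to lie in [0, 1]. *)
definition random_subset :: "nat \<Rightarrow> real \<Rightarrow> nat set pmf" where
  "random_subset n q =
     map_pmf (\<lambda>f. {i \<in> {1..n}. f i}) (Pi_pmf {1..n} False (\<lambda>_. bernoulli_pmf q))"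

end

theory Submission
  imports Defs
begin

text \<open>Call an element of A prime if it is not a product of two elements of A. Primes are coloured red,
  and a composite element is blue unless it is a product of two blue elements. Blue is then
  product-free by construction. If c = a b is red with a, b red, then also c = d e with d, e blue,
  hence composite. Either one of a, b is composite, and so a product of two blue (composite)
  elements, or both are prime. In both cases c has a factorisation over A into l factors together
  with at least 9 - l further divisors in A, or c is a square with at least 5 divisors in A.

  Asymptotically almost surely no such configuration exists: every element of A exceeds n^(1/9),
  so each repetition of a factor saves n^(1/9) in the count, and k distinct elements of this kind are
  determined, up to a power of D(n), by one number of size at most n^(k/9).\<close>

section \<open>Colouring of a set with sparse divisors\<close>

function blue :: "nat set \<Rightarrow> nat \<Rightarrow> bool" where
  "blue A c \<longleftrightarrow> (\<exists>a\<in>A. \<exists>b\<in>A. c = a * b) \<and>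
     \<not> (\<exists>a\<in>{..<c}. \<exists>b\<in>{..<c}. a \<in> A \<and> b \<in> A \<and> blue A a \<and> blue A b \<and> c = a * b)"
  by auto
termination by (relation "Wellfounded.measure snd") auto

declare blue.simps [simp del]

text \<open>Isolates the properties of the random set that the colouring argument uses, so that this
  part is deterministic. The list \<open>fs\<close> counts factors with multiplicity;
  \<open>S\<close> collects further divisors, and the product itself may be one of them. Each
  pattern below is refuted by exhibiting nine factors and divisors, or five divisors of a
  square.\<close>

locale sparse_divisors =
  fixes A :: "nat set"
  assumes ge2: "t \<in> A \<Longrightarrow> 2 \<le> t"
    and few_divisors: "\<lbrakk>set fs \<subseteq> A; S \<subseteq> A; S \<inter> set fs = {}; prod_list fs \<in> A;
      \<And>s. s \<in> S \<Longrightarrow> s dvd prod_list fs\<rbrakk> \<Longrightarrow> length fs + card S < 9"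
    and few_divisors_square: "\<lbrakk>S \<subseteq> A; s ^ 2 \<in> A; \<And>t. t \<in> S \<Longrightarrow> t dvd s ^ 2\<rbrakk> \<Longrightarrow> card S < 5"
begin

lemma factors_less:
  assumes "x \<in> A" "y \<in> A"
  shows "x < x * y" "y < x * y"
  using ge2[OF assms(1)] ge2[OF assms(2)] by auto

text \<open>Since \<open>c = u * u * w * b\<close>, splitting both copies of \<open>u\<close> gives
  six factors, and \<open>c\<close>, \<open>a\<close>, \<open>u\<close> are three further divisors.
  If \<open>w = u\<close>, then \<open>u\<close> is split a third time: seven factors, with
  \<open>c\<close> and \<open>a\<close> as further divisors.\<close>

lemma no_nested_factor:
  assumes A: "u1 \<in> A" "u2 \<in> A" "u \<in> A" "w \<in> A" "v \<in> A" "a \<in> A" "b \<in> A" "c \<in> A"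
    and eq: "u = u1 * u2" "v = u * w" "a = u * v" "c = a * b"
    and ne: "a \<noteq> b" "u \<noteq> b"
  shows False
proof -
  have lt: "u1 < u" "u2 < u" "u < v" "w < v" "u < a" "v < a" "a < c" "b < c"
    using A eq factors_less by metis+
  show False
  proof (cases "w = u")
    case True
    have "length [u1,u2,u1,u2,u1,u2,b] + card {c,a} < 9"
      by (rule few_divisors) (use A eq True lt ne in \<open>auto simp: mult_ac\<close>)
    then show False using lt by simp
  next
    case False
    have "length [u1,u2,u1,u2,w,b] + card {c,a,u} < 9"
      by (rule few_divisors) (use A eq False lt ne in \<open>auto simp: mult_ac\<close>)
    then show False using lt by simp
  qed
qed

text \<open>Serves a red composite \<open>a\<close>, which is a product of blue, hence composite,
  \<open>u\<close> and \<open>v\<close>; the inequalities express that \<open>b\<close> is red and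
  \<open>u\<close>, \<open>v\<close>, \<open>d\<close>, \<open>e\<close> are blue. Generically the
  five factors \<open>u1\<close>, \<open>u2\<close>, \<open>v1\<close>, \<open>v2\<close>,
  \<open>b\<close> and the divisors \<open>c\<close>, \<open>a\<close>, \<open>u\<close>,
  \<open>v\<close> make nine. The other cases treat coincidences among these.\<close>

lemma no_composite_factor:
  assumes A: "u1 \<in> A" "u2 \<in> A" "v1 \<in> A" "v2 \<in> A" "u \<in> A" "v \<in> A"
      "a \<in> A" "b \<in> A" "c \<in> A" "d \<in> A" "e \<in> A"
    and eq: "u = u1 * u2" "v = v1 * v2" "a = u * v" "c = a * b" "c = d * e"
    and ne: "u \<noteq> b" "v \<noteq> b" "d \<notin> {a, b}" "e \<notin> {a, b}"
  shows False
proof -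
  have lt: "u1 < u" "u2 < u" "v1 < v" "v2 < v" "u < a" "v < a" "a < c" "b < c" "d < c" "e < c"
    using A eq factors_less by metis+
  consider "a = b" | "a \<noteq> b" "u = v" | "a \<noteq> b" "u \<noteq> v" "u \<in> {v1, v2} \<or> v \<in> {u1, u2}"
    | "a \<noteq> b" "u \<noteq> v" "u \<notin> {v1, v2}" "v \<notin> {u1, u2}" by blast
  then show False
  proof cases
    case 1
    have "length [u1,u2,v1,v2,u1,u2,v1,v2] + card {c} < 9"
      by (rule few_divisors) (use A eq 1 lt in \<open>auto simp: mult_ac\<close>)
    then show False by simp
  next
    case 2
    \<comment> \<open>With \<open>u = v\<close> only eight are at hand: five factors and
      \<open>c\<close>, \<open>a\<close>, \<open>u\<close>. Any further divisor \<open>f\<close>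
      completes them, and \<open>d\<close> or \<open>e\<close> will supply it.\<close>
    have main: False if f: "f \<in> A" "f dvd c" "f \<noteq> c" "f \<noteq> a" "f \<noteq> b" "f \<noteq> u" "f \<notin> {u1, u2}" for f
    proof -
      have c: "prod_list [u1,u2,u1,u2,b] = c" using eq 2 by (simp add: mult_ac)
      have "a dvd c" "u dvd c" using eq by simp_all
      then have "length [u1,u2,u1,u2,b] + card {c,a,u,f} < 9"
        by (intro few_divisors, unfold c) (use A f 2 lt ne in auto)
      then show False using lt f by simp
    qed
    have dvd: "d dvd c" "e dvd c" unfolding eq(5) by simp_all
    \<comment> \<open>If one of \<open>d\<close>, \<open>e\<close> equals \<open>u\<close>, the
      other is \<open>u * b\<close>, which exceeds both \<open>u\<close> and \<open>b\<close> and so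
      is a new divisor.\<close>
    have other: False if h: "f \<in> A" "f dvd c" "f \<notin> {a, b}" "f < c" "c = u * f" for f
    proof -
      have "c = u * (u * b)" unfolding eq(3,4) 2(2) by (simp only: mult.assoc)
      then have "u * f = u * (u * b)" using h(5) by simp
      then have "f = u * b" using ge2[OF A(5)] by simp
      then have "u < f" "b < f" using factors_less A by blast+
      then show False using main[of f] h lt by auto
    qed
    have "d \<noteq> u" "e \<noteq> u"
      using other[of e] other[of d] A dvd lt ne eq(5) by (auto simp: mult.commute)
    then have "d \<in> {u1, u2}" "e \<in> {u1, u2}"
      using main[of d] main[of e] A dvd lt ne by auto
    \<comment> \<open>Both \<open>d\<close> and \<open>e\<close> are now proper factors of
      \<open>u = v\<close>, so their product is below \<open>a\<close>, which is below
      \<open>c\<close>.\<close>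
    then have "d * e < u * v"
      using lt 2 by (intro mult_strict_mono') auto
    then show False using lt eq by simp
  next
    case 3
    \<comment> \<open>Commuted copies of the equations reduce the four positions of the nested
      factor to the single pattern of \<open>no_nested_factor\<close>.\<close>
    have eq': "a = v * u" "u = u2 * u1" "v = v2 * v1"
      unfolding eq(1-3) by (simp_all only: mult.commute)
    from 3 consider "u = v1" | "u = v2" | "v = u1" | "v = u2" by blast
    then show False
    proof cases
      case 1
      show False
        by (rule no_nested_factor[of u1 u2 u v2 v a b c]) (fact A | fact eq | fact ne | fact 3 | simp only: 1 eq(2))+
    next
      case 2
      show False
        by (rule no_nested_factor[of u1 u2 u v1 v a b c]) (fact A | fact eq | fact ne | fact 3 | simp only: 2 eq'(3))+
    next
      case 3
      show False
        by (rule no_nested_factor[of v1 v2 v u2 u a b c])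
          (fact A | fact eq | fact eq' | fact ne | fact \<open>a \<noteq> b\<close> | simp only: 3 eq(1))+
    next
      case 4
      show False
        by (rule no_nested_factor[of v1 v2 v u1 u a b c])
          (fact A | fact eq | fact eq' | fact ne | fact \<open>a \<noteq> b\<close> | simp only: 4 eq'(2))+
    qed
  next
    case 4
    have c: "prod_list [u1,u2,v1,v2,b] = c" using eq by (simp add: mult_ac)
    have "a dvd c" "u dvd c" "v dvd c" using eq by simp_all
    then have "length [u1,u2,v1,v2,b] + card {c,a,u,v} < 9"
      by (intro few_divisors, unfold c) (use A 4 lt ne in auto)
    then show False using lt 4 by simp
  qed
qed

text \<open>As \<open>a\<close> and \<open>b\<close> are not products of two elements of
  \<open>A\<close>, they differ from \<open>d\<close>, \<open>e\<close> and from the four factors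
  below them. Generically \<open>x\<close>, \<open>y\<close>, \<open>z\<close>, \<open>w\<close> and
  the divisors \<open>c\<close>, \<open>a\<close>, \<open>b\<close>, \<open>d\<close>,
  \<open>e\<close> make nine. If \<open>a = b\<close> or \<open>d = e\<close>, then \<open>c\<close>
  is a square with five divisors in \<open>A\<close>.\<close>

lemma no_prime_factors:
  assumes A: "x \<in> A" "y \<in> A" "z \<in> A" "w \<in> A" "d \<in> A" "e \<in> A" "a \<in> A" "b \<in> A" "c \<in> A"
    and eq: "d = x * y" "e = z * w" "c = d * e" "c = a * b"
    and prime: "\<And>s t. s \<in> A \<Longrightarrow> t \<in> A \<Longrightarrow> a \<noteq> s * t" "\<And>s t. s \<in> A \<Longrightarrow> t \<in> A \<Longrightarrow> b \<noteq> s * t"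
  shows False
proof -
  have lt: "x < d" "y < d" "z < e" "w < e" "d < c" "e < c" "a < c" "b < c"
    using A eq factors_less by metis+
  have dvd: "a dvd c" "b dvd c" unfolding eq(4) by simp_all
  have dvd': "d dvd c" "e dvd c" unfolding eq(3) by simp_all
  have dvd'': "x dvd c" "z dvd c" unfolding eq(3,1,2) by simp_all
  have cancel: "s = k" if "t * s = t * k" "t \<in> A" for s k t
    using that ge2[of t] by auto
  have cx: "c = x * (y * e)" "c = y * (x * e)" "c = z * (w * d)" "c = w * (z * d)"
    using eq(1-3) by (simp_all add: mult_ac)
  \<comment> \<open>If \<open>r\<close> were one of the four, cancelling it in \<open>c\<close>
    would leave the cofactor \<open>s\<close> as a product of two elements of \<open>A\<close>, such
    as \<open>y * e\<close>.\<close>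
  have nx: "r \<noteq> x" "r \<noteq> y" "r \<noteq> z" "r \<noteq> w"
    if h: "r * s = c" "\<And>i j. i \<in> A \<Longrightarrow> j \<in> A \<Longrightarrow> s \<noteq> i * j" for r s
    using cancel[of x s] cancel[of y s] cancel[of z s] cancel[of w s] h(1) h(2) cx A(1-6) by metis+
  have na: "a \<notin> {x, y, z, w}" using nx[of a b] eq prime by auto
  have nb: "b \<notin> {x, y, z, w}" using nx[of b a] eq prime by (auto simp: mult_ac)
  have nde: "a \<noteq> d" "a \<noteq> e" "b \<noteq> d" "b \<noteq> e" using prime A eq by blast+
  \<comment> \<open>Treats the case where one of \<open>d\<close>, \<open>e\<close> is a factor of
    the other: that factor can be split a second time, which makes up for the lost divisor.\<close>
  have nested: False
    if h: "x' \<in> A" "y' \<in> A" "w' \<in> A" "d' \<in> A" "d' = x' * y'" "c = x' * y' * d' * w'"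
      "a \<notin> {x', y', d', w'}" "b \<notin> {x', y', d', w'}" "a \<noteq> b" for x' y' w' d'
  proof -
    have "d' * (d' * w') = c" using h by (simp add: mult_ac)
    moreover have l: "x' < d'" "y' < d'" "d' < d' * w'" "w' < d' * w'" using factors_less h by simp_all
    moreover have "2 \<le> d'" using ge2 h by blast
    ultimately have "d' * w' < c" "d' dvd c" by auto
    with l have l: "x' < d'" "y' < d'" "d' < c" "w' < c" "d' dvd c" by linarith+
    show False
    proof (cases "w' = d'")
      case True
      have c: "prod_list [x',y',x',y',x',y'] = c" using h True by (simp add: mult_ac)
      have "length [x',y',x',y',x',y'] + card {c,a,b} < 9"
        by (intro few_divisors, unfold c) (use A h(1-4,7,8) lt l dvd in auto)
      then show False using lt h by simp
    next
      case False
      have c: "prod_list [x',y',x',y',w'] = c" using h by (simp add: mult_ac)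
      have "length [x',y',x',y',w'] + card {c,a,b,d'} < 9"
        by (intro few_divisors, unfold c) (use A h(1-4,7,8) lt dvd l False in auto)
      then show False using lt l h by simp
    qed
  qed
  consider "a = b" | "a \<noteq> b" "d = e" | "a \<noteq> b" "d \<noteq> e" "d \<in> {z, w} \<or> e \<in> {x, y}"
    | "a \<noteq> b" "d \<noteq> e" "d \<notin> {z, w}" "e \<notin> {x, y}" by blast
  then show False
  proof cases
    case 1
    have sq: "c = a ^ 2" using eq 1 by (simp add: power2_eq_square)
    have "d \<noteq> e" using eq(3) sq nde(1) power2_eq_imp_eq[of a d] by (auto simp: power2_eq_square)
    \<comment> \<open>The fifth divisor: \<open>x\<close> works unless \<open>x = e\<close>; in that
      case \<open>z < e < d\<close>, so \<open>z\<close> works.\<close>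
    obtain t where t: "t \<in> {x, z}" "t \<notin> {d, e}"
      using lt by (cases "x = e") auto
    have "card {c,a,d,e,t} < 5"
      by (rule few_divisors_square[of _ a], unfold sq[symmetric]) (use A t dvd dvd' dvd'' in auto)
    then show False using lt t \<open>d \<noteq> e\<close> na nde by auto
  next
    case 2
    have sq: "c = d ^ 2" using eq 2 by (simp add: power2_eq_square)
    have "card {c,a,b,d,x} < 5"
      by (rule few_divisors_square[of _ d], unfold sq[symmetric]) (use A dvd dvd' dvd'' in auto)
    then show False using lt na nb nde 2 by auto
  next
    case 3
    have "c = x * y * (z * w)" using eq by simp
    with 3 consider "c = x * y * d * w" | "c = x * y * d * z" | "c = z * w * e * y" | "c = z * w * e * x"
      by (auto simp only: mult_ac)
    then show False
    proof cases
      case 1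
      show False
        by (rule nested[of x y w d]) (use A eq(1) na nb nde 1 \<open>a \<noteq> b\<close> in simp_all)
    next
      case 2
      show False
        by (rule nested[of x y z d]) (use A eq(1) na nb nde 2 \<open>a \<noteq> b\<close> in simp_all)
    next
      case 3
      show False
        by (rule nested[of z w y e]) (use A eq(2) na nb nde 3 \<open>a \<noteq> b\<close> in simp_all)
    next
      case 4
      show False
        by (rule nested[of z w x e]) (use A eq(2) na nb nde 4 \<open>a \<noteq> b\<close> in simp_all)
    qed
  next
    case 4
    have c: "prod_list [x,y,z,w] = c" using eq by (simp add: mult_ac)
    have "length [x,y,z,w] + card {c,a,b,d,e} < 9"
      by (intro few_divisors, unfold c) (use A 4 lt dvd dvd' na nb in auto)
    then show False using lt 4 nde by auto
  qed
qed

lemma blue_iff: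
  "blue A c \<longleftrightarrow> (\<exists>a\<in>A. \<exists>b\<in>A. c = a * b) \<and>
     \<not> (\<exists>a\<in>A. \<exists>b\<in>A. blue A a \<and> blue A b \<and> c = a * b)"
proof -
  have "(\<exists>a\<in>{..<c}. \<exists>b\<in>{..<c}. a \<in> A \<and> b \<in> A \<and> blue A a \<and> blue A b \<and> c = a * b)
      \<longleftrightarrow> (\<exists>a\<in>A. \<exists>b\<in>A. blue A a \<and> blue A b \<and> c = a * b)" (is "?l = ?r")
  proof
    assume ?r
    then obtain a b where "a \<in> A" "b \<in> A" "blue A a" "blue A b" "c = a * b" by blast
    moreover from this have "a \<in> {..<c}" "b \<in> {..<c}" using factors_less by simp_all
    ultimately show ?l by blast
  qed blast
  then show ?thesis by (subst blue.simps) (rule arg_cong2[of _ _ _ _ "\<lambda>P Q. P \<and> \<not> Q"]; simp)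
qed

lemma not_product_Schur: "\<not> product_Schur A"
proof
  assume "product_Schur A"
  then obtain a b c where A: "a \<in> A" "b \<in> A" "c \<in> A" and c: "c = a * b"
    and col: "blue A a = blue A b" "blue A b = blue A c"
    unfolding product_Schur_def by metis
  have composite: "\<exists>s\<in>A. \<exists>r\<in>A. t = s * r" if "blue A t" for t
    using that by (subst (asm) blue_iff) (rule conjunct1)
  have red: "\<exists>s\<in>A. \<exists>r\<in>A. blue A s \<and> blue A r \<and> t = s * r"
    if "\<not> blue A t" "s \<in> A" "r \<in> A" "t = s * r" for t s r
    using that(1) by (subst (asm) blue_iff) (use that(2-) in blast)
  \<comment> \<open>A blue \<open>c\<close> would make \<open>a\<close> and \<open>b\<close> blue,
    and a product of two blue elements is never blue.\<close>
  have c_red: "\<not> blue A c"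
  proof
    assume "blue A c"
    then have "\<not> (\<exists>a\<in>A. \<exists>b\<in>A. blue A a \<and> blue A b \<and> c = a * b)"
      by (subst (asm) blue_iff) (rule conjunct2)
    then show False using A c col \<open>blue A c\<close> by blast
  qed
  obtain d e where de: "d \<in> A" "e \<in> A" "blue A d" "blue A e" "c = d * e"
    using red[OF c_red A(1,2) c] by blast
  have nblue: "\<not> blue A a" "\<not> blue A b" using col c_red by auto
  \<comment> \<open>Stated for an arbitrary pair because it is applied to \<open>a\<close>,
    \<open>b\<close> in both orders.\<close>
  have no_comp: False
    if h: "s \<in> A" "r \<in> A" "a' \<in> A" "b' \<in> A" "a' = s * r" "c = a' * b'"
      "\<not> blue A a'" "\<not> blue A b'" for s r a' b'
  proof -
    obtain u v where uv: "u \<in> A" "v \<in> A" "blue A u" "blue A v" "a' = u * v"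
      using red[OF h(7,1,2,5)] by blast
    obtain u1 u2 where u: "u1 \<in> A" "u2 \<in> A" "u = u1 * u2"
      using composite[OF uv(3)] by blast
    obtain v1 v2 where v: "v1 \<in> A" "v2 \<in> A" "v = v1 * v2"
      using composite[OF uv(4)] by blast
    have "u \<noteq> b'" "v \<noteq> b'" "d \<notin> {a', b'}" "e \<notin> {a', b'}"
      using uv(3,4) h(7,8) de(3,4) by auto
    then show False
      using no_composite_factor[OF u(1,2) v(1,2) uv(1,2) h(3,4) A(3) de(1,2) u(3) v(3) uv(5) h(6) de(5)]
      by simp
  qed
  obtain x y where x: "x \<in> A" "y \<in> A" "d = x * y" using composite[OF de(3)] by blast
  obtain z w where z: "z \<in> A" "w \<in> A" "e = z * w" using composite[OF de(4)] by blast
  have "a \<noteq> s * t" if "s \<in> A" "t \<in> A" for s t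
    using no_comp[OF that A(1,2) _ c nblue] by blast
  moreover have "b \<noteq> s * t" if "s \<in> A" "t \<in> A" for s t
    using no_comp[OF that A(2,1) _ _ nblue(2,1)] c by (auto simp: mult.commute)
  ultimately show False
    using no_prime_factors[OF x(1,2) z(1,2) de(1,2) A x(3) z(3) de(5) c] by blast
qed

end

section \<open>Probability of containing a member of a family\<close>

lemma prob_superset_random_subset:
  assumes "T \<subseteq> {1..n}" "0 \<le> q" "q \<le> 1"
  shows "measure_pmf.prob (random_subset n q) {A. T \<subseteq> A} = q ^ card T"
proof -
  have "(\<lambda>f. {i \<in> {1..n}. f i}) -` {A. T \<subseteq> A} = Pi {1..n} (\<lambda>i. if i \<in> T then {True} else UNIV)"
    using assms(1) by (auto simp: Pi_def split: if_splits)
  then have "measure_pmf.prob (random_subset n q) {A. T \<subseteq> A} =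
      (\<Prod>i\<in>{1..n}. measure_pmf.prob (bernoulli_pmf q) (if i \<in> T then {True} else UNIV))"
    by (simp add: random_subset_def measure_Pi_pmf_Pi)
  also have "\<dots> = (\<Prod>i\<in>{1..n}. if i \<in> T then q else 1)"
    using assms by (intro prod.cong) (auto simp: measure_pmf_single)
  also have "\<dots> = q ^ card ({1..n} \<inter> T)"
    by (simp add: prod.If_cases)
  finally show ?thesis using assms(1) by (simp add: Int_absorb1)
qed

text \<open>Union bound. The real bound \<open>K\<close> leaves room for estimates with fractional
  powers of \<open>n\<close>.\<close>

lemma prob_contains_member_le:
  assumes "finite F" "\<And>T. T \<in> F \<Longrightarrow> T \<subseteq> {1..n} \<and> card T = k" "0 \<le> q" "q \<le> 1"
    and "real (card F) \<le> K"
  shows "measure_pmf.prob (random_subset n q) {A. \<exists>T\<in>F. T \<subseteq> A} \<le> K * q ^ k"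
proof -
  have "measure_pmf.prob (random_subset n q) (\<Union>T\<in>F. {A. T \<subseteq> A})
      \<le> (\<Sum>T\<in>F. measure_pmf.prob (random_subset n q) {A. T \<subseteq> A})"
    by (rule measure_UNION_le) (use assms in auto)
  also have "\<dots> = (\<Sum>T\<in>F. q ^ k)"
    using assms by (intro sum.cong) (auto simp: prob_superset_random_subset)
  also have "\<dots> \<le> K * q ^ k" using assms by (simp add: mult_right_mono)
  finally show ?thesis by (simp add: Collect_bex_eq)
qed

section \<open>Divisor bounds\<close>

lemma card_divisors_le_max_divisors:
  assumes "1 \<le> c" "c \<le> n"
  shows "card {d. d dvd c} \<le> max_divisors n"
  unfolding max_divisors_def num_divisors_def using assms by (intro Max_ge) auto

lemma max_divisors_pos: "1 \<le> n \<Longrightarrow> 1 \<le> max_divisors n"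
  using card_divisors_le_max_divisors[of 1 n] by simp

text \<open>The powers of 2 up to \<open>2 ^ k\<close> are \<open>k + 1\<close> divisors of
  \<open>2 ^ k\<close>. This is what makes a failure probability of order 1/D(n) vanish in the
  limit.\<close>

lemma filterlim_max_divisors: "filterlim max_divisors at_top sequentially"
  unfolding filterlim_at_top
proof
  fix k :: nat
  show "\<forall>\<^sub>F n in sequentially. k \<le> max_divisors n"
    using eventually_ge_at_top[of "2 ^ k"]
  proof eventually_elim
    case (elim n)
    have "card ((\<lambda>i. 2 ^ i :: nat) ` {..k}) \<le> card {d. d dvd (2 ^ k :: nat)}"
      by (intro card_mono) (auto intro: le_imp_power_dvd)
    moreover have "card ((\<lambda>i. 2 ^ i :: nat) ` {..k}) = Suc k"
      by (simp add: card_image inj_on_def)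
    ultimately show ?case
      using card_divisors_le_max_divisors[OF _ elim] by fastforce
  qed
qed

definition divisor_lists :: "nat \<Rightarrow> nat \<Rightarrow> nat list set" where
  "divisor_lists k c = {gs. set gs \<subseteq> {d. d dvd c} \<and> length gs = k}"

lemma divisor_lists:
  assumes "1 \<le> c" "c \<le> n"
  shows finite_divisor_lists: "finite (divisor_lists k c)"
    and card_divisor_lists_le: "card (divisor_lists k c) \<le> max_divisors n ^ k"
proof -
  have "finite {d. d dvd c}" using assms by simp
  then show "finite (divisor_lists k c)" "card (divisor_lists k c) \<le> max_divisors n ^ k"
    unfolding divisor_lists_def using assms
    by (auto simp: card_lists_length_eq finite_lists_length_eq
        intro!: power_mono card_divisors_le_max_divisors)
qed

lemma card_Sigma_le:
  assumes "finite B" "\<And>b. b \<in> B \<Longrightarrow> finite (F b)" "\<And>b. b \<in> B \<Longrightarrow> card (F b) \<le> K"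
  shows "card (Sigma B F) \<le> card B * K"
  using assms sum_bounded_above[of B "\<lambda>b. card (F b)" K] by simp

text \<open>Each repeated occurrence in the list contributes a further factor of at least
  \<open>L\<close> beyond the product of the distinct entries.\<close>

lemma prod_list_ge_prod_set:
  fixes fs :: "nat list" and L :: real
  assumes "\<And>t. t \<in> set fs \<Longrightarrow> L \<le> real t" "0 \<le> L"
  shows "real (\<Prod>(set fs)) * L ^ (length fs - card (set fs)) \<le> real (prod_list fs)"
  using assms(1)
proof (induction fs)
  case (Cons x fs)
  have IH: "real (\<Prod>(set fs)) * L ^ (length fs - card (set fs)) \<le> real (prod_list fs)"
    using Cons by simp
  show ?case
  proof (cases "x \<in> set fs")
    case True
    have "L * (real (\<Prod>(set fs)) * L ^ (length fs - card (set fs))) \<le> real x * real (prod_list fs)"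
      using Cons.prems assms(2) IH by (intro mult_mono) (auto simp: prod_nonneg)
    then show ?thesis
      using True by (simp add: insert_absorb Suc_diff_le card_length mult_ac)
  next
    case False
    then show ?thesis using mult_left_mono[OF IH, of "real x"] by (simp add: mult_ac)
  qed
qed simp

section \<open>Counting bad configurations\<close>

text \<open>The cardinality condition forces \<open>gs\<close> to be distinct and disjoint from
  \<open>fs\<close>. Fixing \<open>r\<close> fixes the size of the members, and hence the power of
  the density in the union bound.\<close>

definition factor_family :: "nat \<Rightarrow> nat \<Rightarrow> nat \<Rightarrow> nat set set" where
  "factor_family n l r = {set fs \<union> set gs | fs gs.
     set fs \<union> set gs \<subseteq> {1..n} \<and> length fs = l \<and> length gs = 9 - l \<and> card (set fs) = r \<and>
     (\<forall>g\<in>set gs. g dvd prod_list fs) \<and> prod_list fs \<le> n \<and>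
     (\<forall>t\<in>set fs. real n powr (1/9) < real t) \<and> card (set fs \<union> set gs) = 9 - l + r}"

definition square_family :: "nat \<Rightarrow> nat set set" where
  "square_family n = {set gs | gs s. set gs \<subseteq> {1..n} \<and> 1 \<le> s \<and> s ^ 2 \<le> n \<and> length gs = 5 \<and>
     (\<forall>g\<in>set gs. g dvd s ^ 2) \<and> card (set gs) = 5}"

lemma factor_family_subset: "factor_family n l r \<subseteq> Pow {1..n}"
  unfolding factor_family_def by blast

lemma square_family_subset: "square_family n \<subseteq> Pow {1..n}"
  unfolding square_family_def by blast

lemma finite_families: "finite (factor_family n l r)" "finite (square_family n)"
  by (rule finite_subset[OF factor_family_subset] finite_subset[OF square_family_subset]; simp)+

text \<open>A member is encoded by the product \<open>m\<close> of its distinct factors, the list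
  \<open>fs\<close> of divisors of \<open>m\<close>, and the list \<open>gs\<close> of divisors of
  \<open>prod_list fs\<close>. Given \<open>m\<close>, there are at most D^l choices for
  \<open>fs\<close> and D^(9-l) for \<open>gs\<close>. The \<open>l - r\<close> repetitions each
  save n^(1/9), which bounds \<open>m\<close> by \<open>N\<close>.\<close>

lemma card_factor_family_le:
  assumes n: "1 \<le> n" and "l \<le> 9" "r \<le> l"
  shows "real (card (factor_family n l r)) \<le> real n powr (real (9 - l + r) / 9) * real (max_divisors n) ^ 9"
proof -
  define D where "D = max_divisors n"
  define N where "N = real n powr (real (9 - l + r) / 9)"
  define M where "M = nat \<lfloor>N\<rfloor>"
  \<comment> \<open>As \<open>r \<le> l\<close>, the exponent is at most 1; so
    \<open>m \<le> n\<close>, and the divisors of \<open>m\<close> number at most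
    \<open>D\<close>.\<close>
  have "N \<le> real n powr 1" unfolding N_def using assms by (intro powr_mono) auto
  then have M: "M \<le> n" "real M \<le> N" using n unfolding M_def N_def by (auto simp: floor_le_iff le_floor_iff nat_le_iff)
  define P where "P m = {fs \<in> divisor_lists l m. 1 \<le> prod_list fs \<and> prod_list fs \<le> n}" for m
  define G where "G = (SIGMA m:{1..M}. SIGMA fs:P m. divisor_lists (9 - l) (prod_list fs))"
  have P: "finite (P m)" "card (P m) \<le> D ^ l" if "m \<in> {1..M}" for m
  proof -
    have m: "1 \<le> m" "m \<le> n" using that M by auto
    show "finite (P m)" unfolding P_def using finite_divisor_lists[OF m] by simp
    have "card (P m) \<le> card (divisor_lists l m)"
      unfolding P_def using finite_divisor_lists[OF m] by (intro card_mono) auto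
    then show "card (P m) \<le> D ^ l" using card_divisor_lists_le[OF m, of l] unfolding D_def by simp
  qed
  have Q: "finite (divisor_lists (9 - l) (prod_list fs))"
      "card (divisor_lists (9 - l) (prod_list fs)) \<le> D ^ (9 - l)" if "fs \<in> P m" for fs m
    using that finite_divisor_lists card_divisor_lists_le unfolding P_def D_def by blast+
  have inner: "finite (SIGMA fs:P m. divisor_lists (9 - l) (prod_list fs))"
      "card (SIGMA fs:P m. divisor_lists (9 - l) (prod_list fs)) \<le> D ^ 9" if "m \<in> {1..M}" for m
  proof -
    show "finite (SIGMA fs:P m. divisor_lists (9 - l) (prod_list fs))"
      using P[OF that] Q by blast
    have "card (SIGMA fs:P m. divisor_lists (9 - l) (prod_list fs)) \<le> card (P m) * D ^ (9 - l)"
      using P[OF that] Q by (intro card_Sigma_le) auto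
    also have "\<dots> \<le> D ^ l * D ^ (9 - l)" using P[OF that] by simp
    finally show "card (SIGMA fs:P m. divisor_lists (9 - l) (prod_list fs)) \<le> D ^ 9"
      using assms by (simp flip: power_add)
  qed
  have "finite G" unfolding G_def using inner by blast
  have "card G \<le> card {1..M} * D ^ 9"
    unfolding G_def using inner by (intro card_Sigma_le) auto
  have "factor_family n l r \<subseteq> (\<lambda>(m, fs, gs). set fs \<union> set gs) ` G"
  proof
    fix T assume "T \<in> factor_family n l r"
    then obtain fs gs where T: "T = set fs \<union> set gs" "set fs \<union> set gs \<subseteq> {1..n}" "length fs = l"
      "length gs = 9 - l" "card (set fs) = r" "\<And>g. g \<in> set gs \<Longrightarrow> g dvd prod_list fs"
      "prod_list fs \<le> n" "\<And>t. t \<in> set fs \<Longrightarrow> real n powr (1/9) < real t"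
      unfolding factor_family_def by blast
    define m where "m = \<Prod>(set fs)"
    have "real m * (real n powr (1/9)) ^ (l - r) \<le> real (prod_list fs)"
      using prod_list_ge_prod_set[of fs "real n powr (1/9)"] T unfolding m_def by (auto intro: less_imp_le)
    also have "\<dots> \<le> real n" using T by simp
    also have "real n = N * (real n powr (1/9)) ^ (l - r)"
      using n assms unfolding N_def
      by (simp add: powr_powr flip: powr_realpow powr_add add_divide_distrib)
    finally have "real m \<le> N" using n by simp
    then have "m \<le> M" unfolding M_def by (simp add: le_nat_floor)
    moreover have "1 \<le> m" using T unfolding m_def by (auto intro!: prod_pos simp: Suc_le_eq)
    moreover have "fs \<in> P m"
    proof -
      have "0 \<notin> set fs" using T by auto
      then have "1 \<le> prod_list fs" by (auto simp: Suc_le_eq prod_list_zero_iff intro: ccontr)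
      then show ?thesis using T unfolding P_def divisor_lists_def m_def by auto
    qed
    ultimately have "(m, fs, gs) \<in> G" unfolding G_def using T by (auto simp: divisor_lists_def)
    then show "T \<in> (\<lambda>(m, fs, gs). set fs \<union> set gs) ` G"
      by (rule rev_image_eqI) (simp add: T(1))
  qed
  then have "card (factor_family n l r) \<le> card G"
    using \<open>finite G\<close> by (rule surj_card_le[rotated])
  also have "\<dots> \<le> M * D ^ 9" using \<open>card G \<le> _\<close> by simp
  finally have "real (card (factor_family n l r)) \<le> real M * real D ^ 9"
    by (metis of_nat_le_iff of_nat_mult of_nat_power)
  also have "\<dots> \<le> N * real D ^ 9" using M by (simp add: mult_right_mono)
  finally show ?thesis unfolding N_def D_def .
qed

text \<open>At most sqrt(n) values of \<open>s\<close> and D^5 lists of divisors for each. Both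
  exponents are relaxed, 1/2 to 5/9 and 5 to 9, to match the shape of the bound for
  \<open>factor_family\<close> at size 5.\<close>

lemma card_square_family_le:
  assumes n: "1 \<le> n"
  shows "real (card (square_family n)) \<le> real n powr (5/9) * real (max_divisors n) ^ 9"
proof -
  define D where "D = max_divisors n"
  define M where "M = nat \<lfloor>sqrt n\<rfloor>"
  have "sqrt n = real n powr (1/2)" by (simp add: powr_half_sqrt)
  also have "\<dots> \<le> real n powr (5/9)" using n by (intro powr_mono) auto
  finally have M: "real M \<le> real n powr (5/9)" unfolding M_def by (simp add: nat_le_iff) linarith
  have sq: "s ^ 2 \<le> n \<longleftrightarrow> s \<le> M" for s
  proof -
    have "s ^ 2 \<le> n \<longleftrightarrow> sqrt (real (s ^ 2)) \<le> sqrt (real n)"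
      by (simp only: real_sqrt_le_iff of_nat_le_iff)
    also have "\<dots> \<longleftrightarrow> s \<le> M" unfolding M_def by (simp add: le_nat_iff le_floor_iff)
    finally show ?thesis .
  qed
  define G where "G = (SIGMA s:{1..M}. divisor_lists 5 (s ^ 2))"
  have L: "finite (divisor_lists 5 (s ^ 2))" "card (divisor_lists 5 (s ^ 2)) \<le> D ^ 5" if "s \<in> {1..M}" for s
    using that finite_divisor_lists[of "s ^ 2" n] card_divisor_lists_le[of "s ^ 2" n] sq[of s]
    unfolding D_def by auto
  have "finite G" unfolding G_def using L by blast
  have "card G \<le> card {1..M} * D ^ 5"
    unfolding G_def using L by (intro card_Sigma_le) auto
  have "square_family n \<subseteq> (\<lambda>(s, gs). set gs) ` G"
    unfolding square_family_def G_def divisor_lists_def sq by (force simp: image_iff)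
  then have "card (square_family n) \<le> card G"
    using \<open>finite G\<close> by (rule surj_card_le[rotated])
  also have "\<dots> \<le> M * D ^ 9"
    using \<open>card G \<le> _\<close> power_increasing[of 5 9 D] max_divisors_pos[OF n] unfolding D_def
    by (auto elim!: order_trans)
  finally have "real (card (square_family n)) \<le> real M * real D ^ 9"
    by (metis of_nat_le_iff of_nat_mult of_nat_power)
  also have "\<dots> \<le> real n powr (5/9) * real D ^ 9" using M by (simp add: mult_right_mono)
  finally show ?thesis unfolding D_def .
qed

section \<open>From absent configurations to a small probability\<close>

lemma not_product_Schur_if_no_bad_configuration:
  assumes A: "A \<subseteq> {1..n}"
    and large: "\<And>t. t \<in> A \<Longrightarrow> real n powr (1/9) < real t"
    and fac: "\<And>l r T. l \<le> 8 \<Longrightarrow> r \<le> l \<Longrightarrow> T \<in> factor_family n l r \<Longrightarrow> \<not> T \<subseteq> A"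
    and sq: "\<And>T. T \<in> square_family n \<Longrightarrow> \<not> T \<subseteq> A"
  shows "\<not> product_Schur A"
proof -
  have "sparse_divisors A"
  proof
    show "2 \<le> t" if "t \<in> A" for t
    proof -
      have "1 \<le> n" using A that by auto
      then have "1 \<le> real n powr (1/9)" by (simp add: ge_one_powr_ge_zero)
      then show ?thesis using large[OF that] by linarith
    qed
  next
    fix fs S assume h: "set fs \<subseteq> A" "S \<subseteq> A" "S \<inter> set fs = {}" "prod_list fs \<in> A"
      "\<And>s. s \<in> S \<Longrightarrow> s dvd prod_list fs"
    show "length fs + card S < 9"
    proof (rule ccontr)
      assume c: "\<not> length fs + card S < 9"
      have n: "1 \<le> n" "prod_list fs \<le> n" using h A by auto
      \<comment> \<open>Nine factors, each above n^(1/9), would have a product above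
        \<open>n\<close>.\<close>
      have l: "length fs \<le> 8"
      proof (rule ccontr)
        assume "\<not> length fs \<le> 8"
        then have len: "9 \<le> length fs" by simp
        define L where "L = real n powr (1/9)"
        have L: "1 \<le> L" using n unfolding L_def by (simp add: ge_one_powr_ge_zero)
        have strict: "gs \<noteq> [] \<Longrightarrow> set gs \<subseteq> A \<Longrightarrow> L ^ length gs < real (prod_list gs)" for gs
        proof (induction gs)
          case (Cons x gs)
          have x: "L < real x" using large Cons.prems unfolding L_def by simp
          show ?case
          proof (cases "gs = []")
            case False
            then have "L ^ length gs < real (prod_list gs)" using Cons by simp
            then show ?thesis using x L by (simp add: mult_strict_mono)
          qed (use x in simp)
        qed simp
        have "real n = L ^ 9" unfolding L_def using n by (simp add: powr_powr flip: powr_realpow)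
        also have "\<dots> \<le> L ^ length fs" using L len by (intro power_increasing)
        also have "\<dots> < real (prod_list fs)" using strict[of fs] h(1) len by fastforce
        finally show False using n by simp
      qed
      \<comment> \<open>Trimming \<open>S\<close> to exactly \<open>9 - length fs\<close> elements
        gives a member of one of finitely many families of sets of fixed size.\<close>
      obtain S' where S': "S' \<subseteq> S" "card S' = 9 - length fs" "finite S'"
      proof (rule obtain_subset_with_card_n)
        show "9 - length fs \<le> card S" using c by simp
      qed
      obtain gs where gs: "set gs = S'" "length gs = 9 - length fs"
        using finite_distinct_list[OF S'(3)] S' distinct_card by metis
      have "set fs \<inter> set gs = {}" using gs S' h by blast
      then have "card (set fs \<union> set gs) = 9 - length fs + card (set fs)"
        using gs S' by (simp add: card_Un_disjoint)
      moreover have "set fs \<union> set gs \<subseteq> A" using gs(1) S'(1) h(1,2) by blast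
      moreover from this have "set fs \<union> set gs \<subseteq> {1..n}" using A by blast
      moreover have "\<forall>g\<in>set gs. g dvd prod_list fs" using gs(1) S'(1) h(5) by blast
      moreover have "\<forall>t\<in>set fs. real n powr (1/9) < real t" using large h(1) by blast
      ultimately have "set fs \<union> set gs \<in> factor_family n (length fs) (card (set fs))"
        unfolding factor_family_def mem_Collect_eq using gs(2) n(2)
        by (intro exI[of _ fs] exI[of _ gs] conjI refl)
      then show False using fac[OF l card_length] \<open>set fs \<union> set gs \<subseteq> A\<close> by blast
    qed
  next
    fix S s assume h: "S \<subseteq> A" "s ^ 2 \<in> A" "\<And>t. t \<in> S \<Longrightarrow> t dvd s ^ 2"
    show "card S < 5"
    proof (rule ccontr)
      assume "\<not> card S < 5"
      then obtain S' where S': "S' \<subseteq> S" "card S' = 5" "finite S'"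
        using obtain_subset_with_card_n[of 5 S] by (auto simp: not_less)
      obtain gs where gs: "set gs = S'" "length gs = 5"
        using finite_distinct_list[OF S'(3)] S' distinct_card by metis
      have "1 \<le> s" "s ^ 2 \<le> n" using h A by (auto simp: Suc_le_eq intro: ccontr)
      then have "set gs \<in> square_family n"
        unfolding square_family_def mem_Collect_eq
        using gs S' h A by (intro exI[of _ gs] exI[of _ s]) auto
      then show False using sq gs S' h by blast
    qed
  qed
  then show ?thesis by (rule sparse_divisors.not_product_Schur)
qed

text \<open>The constant is 83 = 1 + 81 + 1: one event for an element of size at most n^(1/9), nine
  times nine for the pairs \<open>(l, r)\<close>, and one for squares. Each has probability at most
  \<open>1 / D\<close>.\<close>

lemma prob_product_Schur_le:
  assumes n: "1 \<le> n" and q: "0 \<le> q" "q \<le> 1" "q \<le> real n powr (- (1 / 9)) * inverse (omega n)"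
  shows "measure_pmf.prob (random_subset n q) {A. product_Schur A} \<le> 83 / real (max_divisors n)"
proof -
  let ?P = "measure_pmf.prob (random_subset n q)"
  define D where "D = real (max_divisors n)"
  define x where "x = real n powr (1/9) * q"
  have D: "1 \<le> D" unfolding D_def using max_divisors_pos[OF n] by simp
  have x0: "0 \<le> x" unfolding x_def using q by simp
  have "x \<le> real n powr (1/9) * (real n powr (- (1 / 9)) * inverse (omega n))"
    unfolding x_def using q by (intro mult_left_mono) auto
  also have "\<dots> = inverse (D ^ 100)"
    using n by (simp add: omega_def D_def flip: mult.assoc powr_add)
  finally have x: "x \<le> inverse (D ^ 100)" .
  also have "\<dots> \<le> 1" using D by (simp add: inverse_le_1_iff)
  finally have x1: "x \<le> 1" .
  have D91: "D \<le> D ^ 91" using D by (intro self_le_power) auto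
  \<comment> \<open>With \<open>x\<close> at most D^(-100), a family of at most n^(k/9) D^9 sets of
    size \<open>k\<close> contributes at most D^9 x^k, which is at most D^(-91).\<close>
  have bound: "real n powr (real k / 9) * D ^ 9 * q ^ k \<le> 1 / D" if "1 \<le> k" for k
  proof -
    have "real n powr (real k / 9) * q ^ k = x ^ k"
      unfolding x_def using n by (simp add: power_mult_distrib powr_powr flip: powr_realpow)
    then have "real n powr (real k / 9) * D ^ 9 * q ^ k = D ^ 9 * x ^ k" by (simp add: mult_ac)
    also have "\<dots> \<le> D ^ 9 * x ^ 1"
      using D x0 x1 that by (intro mult_left_mono power_decreasing) auto
    also have "\<dots> \<le> D ^ 9 * inverse (D ^ 100)" using x D by (intro mult_left_mono) auto
    also have "\<dots> = 1 / D ^ 91" using D by (simp add: field_simps flip: power_add)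
    also have "\<dots> \<le> 1 / D" using D91 D by (intro divide_left_mono) auto
    finally show ?thesis .
  qed
  define E0 where "E0 = {A. \<exists>T\<in>(\<lambda>t. {t}) ` {t\<in>{1..n}. real t \<le> real n powr (1/9)}. T \<subseteq> A}"
  define E1 where "E1 l r = {A. \<exists>T\<in>factor_family n l r. T \<subseteq> A}" for l r
  define E2 where "E2 = {A. \<exists>T\<in>square_family n. T \<subseteq> A}"
  define I where "I = {..8::nat} \<times> {..8::nat}"
  \<comment> \<open>Pairs with \<open>r > l\<close> get the empty event, so that the index set is a
    full square.\<close>
  define E where "E i = (case i of (l, r) \<Rightarrow> if r \<le> l then E1 l r else {})" for i
  have p0: "?P E0 \<le> 1 / D"
  proof -
    have "{t\<in>{1..n}. real t \<le> real n powr (1/9)} \<subseteq> {1..nat \<lfloor>real n powr (1/9)\<rfloor>}"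
      by (auto simp: le_nat_floor)
    then have "card ((\<lambda>t. {t}) ` {t\<in>{1..n}. real t \<le> real n powr (1/9)}) \<le> nat \<lfloor>real n powr (1/9)\<rfloor>"
      using card_mono[of "{1..nat \<lfloor>real n powr (1/9)\<rfloor>}"]
      by (intro order_trans[OF card_image_le]) fastforce+
    also have "real \<dots> \<le> real n powr (1/9)" by simp
    finally have "real (card ((\<lambda>t. {t}) ` {t\<in>{1..n}. real t \<le> real n powr (1/9)})) \<le> real n powr (1/9)" by simp
    also have "\<dots> \<le> real n powr (real 1 / 9) * D ^ 9"
      using mult_left_mono[OF one_le_power[OF D, of 9], of "real n powr (1/9)"] by simp
    finally have "?P E0 \<le> (real n powr (real 1 / 9) * D ^ 9) * q ^ 1"
      unfolding E0_def using q by (intro prob_contains_member_le) auto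
    then show ?thesis using bound[of 1] by simp
  qed
  have p1: "?P (E i) \<le> 1 / D" if "i \<in> I" for i
  proof (cases i)
    case (Pair l r)
    show ?thesis
    proof (cases "r \<le> l")
      case True
      have "?P (E1 l r) \<le> (real n powr (real (9 - l + r) / 9) * D ^ 9) * q ^ (9 - l + r)"
        unfolding E1_def D_def using that Pair True q n unfolding I_def
        by (intro prob_contains_member_le card_factor_family_le finite_families)
          (auto simp: factor_family_def)
      \<comment> \<open>Since \<open>l \<le> 8\<close>, the size \<open>9 - l + r\<close> is
        positive, as \<open>bound\<close> requires.\<close>
      also have "\<dots> \<le> 1 / D" using that Pair by (intro bound) (auto simp: I_def)
      finally show ?thesis using Pair True by (simp add: E_def)
    qed (use Pair D in \<open>simp add: E_def\<close>)
  qed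
  have p2: "?P E2 \<le> 1 / D"
  proof -
    have "?P E2 \<le> (real n powr (real 5 / 9) * D ^ 9) * q ^ 5"
      unfolding E2_def D_def using card_square_family_le[OF n] q
      by (intro prob_contains_member_le finite_families) (auto simp: square_family_def)
    then show ?thesis using bound[of 5] by simp
  qed
  have supp: "A \<subseteq> {1..n}" if "A \<in> set_pmf (random_subset n q)" for A
    using that by (auto simp: random_subset_def)
  \<comment> \<open>Restriction to the support ensures that \<open>A\<close> lies in
    \<open>{1..n}\<close>.\<close>
  have sub: "{A. product_Schur A} \<inter> set_pmf (random_subset n q) \<subseteq> E0 \<union> (\<Union>i\<in>I. E i) \<union> E2"
  proof
    fix A assume A: "A \<in> {A. product_Schur A} \<inter> set_pmf (random_subset n q)"
    show "A \<in> E0 \<union> (\<Union>i\<in>I. E i) \<union> E2"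
    proof (rule ccontr)
      assume nA: "A \<notin> E0 \<union> (\<Union>i\<in>I. E i) \<union> E2"
      have "\<not> product_Schur A"
      proof (rule not_product_Schur_if_no_bad_configuration)
        show "A \<subseteq> {1..n}" using A supp by blast
        show "real n powr (1/9) < real t" if "t \<in> A" for t
          using nA that supp[of A] A unfolding E0_def by force
        show "\<not> T \<subseteq> A" if h: "l \<le> 8" "r \<le> l" "T \<in> factor_family n l r" for l r T
        proof -
          have "(l, r) \<in> I" using h by (simp add: I_def)
          then have "A \<notin> E (l, r)" using nA by blast
          then show ?thesis using h unfolding E_def E1_def by auto
        qed
        show "\<not> T \<subseteq> A" if "T \<in> square_family n" for T
          using nA that unfolding E2_def by blast
      qed
      then show False using A by simp
    qed
  qed
  have "?P {A. product_Schur A} = ?P ({A. product_Schur A} \<inter> set_pmf (random_subset n q))"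
    by (simp add: measure_Int_set_pmf)
  also have "\<dots> \<le> ?P (E0 \<union> (\<Union>i\<in>I. E i) \<union> E2)"
    using sub by (intro measure_pmf.finite_measure_mono) auto
  also have "\<dots> \<le> ?P E0 + ?P (\<Union>i\<in>I. E i) + ?P E2"
    by (intro order_trans[OF measure_Un_le] add_right_mono) (auto intro: measure_Un_le)
  also have "?P (\<Union>i\<in>I. E i) \<le> (\<Sum>i\<in>I. ?P (E i))"
    by (rule measure_UNION_le) (auto simp: I_def)
  also have "\<dots> \<le> (\<Sum>i\<in>I. 1 / D)" by (rule sum_mono) (rule p1)
  also have "\<dots> = 81 / D" by (simp add: I_def)
  finally show ?thesis using p0 p2 unfolding D_def by (simp add: field_simps)
qed

theorem theorem2p1:
  fixes p :: "nat \<Rightarrow> real"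
  assumes "\<And>n. n \<ge> 1 \<Longrightarrow> 0 \<le> p n \<and> p n \<le> 1"
    and "\<And>n. n \<ge> 1 \<Longrightarrow> p n \<le> real n powr (- (1 / 9)) * inverse (omega n)"
  shows "(\<lambda>n. measure_pmf.prob (random_subset n (p n)) {A. \<not> product_Schur A})
           \<longlonglongrightarrow> 1"
proof -
  let ?f = "\<lambda>n. measure_pmf.prob (random_subset n (p n)) {A. product_Schur A}"
  have "filterlim (\<lambda>n. real (max_divisors n)) at_top sequentially"
    by (rule filterlim_compose[OF filterlim_real_sequentially filterlim_max_divisors])
  then have "(\<lambda>n. 83 / real (max_divisors n)) \<longlonglongrightarrow> 0"
    by (intro tendsto_divide_0[OF tendsto_const] filterlim_at_top_imp_at_infinity)
  \<comment> \<open>Only for \<open>n \<ge> 1\<close>, since \<open>max_divisors 0\<close> is the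
    maximum of an empty set.\<close>
  moreover have "\<forall>\<^sub>F n in sequentially. ?f n \<le> 83 / real (max_divisors n)"
    using eventually_ge_at_top[of 1] by eventually_elim (use assms prob_product_Schur_le in simp)
  ultimately have "?f \<longlonglongrightarrow> 0"
    by (intro tendsto_sandwich[of "\<lambda>_. 0" ?f sequentially "\<lambda>n. 83 / real (max_divisors n)"] tendsto_const) auto
  then have "(\<lambda>n. 1 - ?f n) \<longlonglongrightarrow> 1 - 0" by (intro tendsto_diff tendsto_const)
  moreover have "measure_pmf.prob (random_subset n (p n)) {A. \<not> product_Schur A} = 1 - ?f n" for n
    using measure_pmf.prob_compl[of "{A. product_Schur A}" "random_subset n (p n)"]
    by (simp add: Compl_eq_Diff_UNIV[symmetric] Collect_neg_eq)
  ultimately show ?thesis by simp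
qed

end
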